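(* Let $h:S^1\to S^1$ be differentiable, let $\kappa_z>0$ and $\Delta t>0$, and suppose that, given the hidden angle $\varphi_t\in S^1$, an observation $Z_t\in S^1$ is drawn from the von Mises distribution $$Z_t\sim\mathcal{VM}\big(h(\varphi_t),\alpha(\kappa_z,\Delta t)\big).$$ If $\alpha$ is chosen such that $$\alpha(\kappa_z,\Delta t)=\xi^{-1}(\kappa_z\,\Delta t),$$ where $\xi^{-1}$ is the inverse of $\xi(x)=x\,\frac{I_1(x)}{I_0(x)}$ on $[0,\infty)$, then the Fisher information $\mathcal{I}(\varphi_t)$ about $\varphi_t$ conveyed by the observation $Z_t$ scales linearly with the sampling time step and the observation precision: $\mathcal{I}(\varphi_t)\propto\kappa_z\,\Delta t$, the constant of proportionality not depending on $\kappa_z$ or $\Delta t$ (it may depend on $h$ and $\varphi_t$).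
   Context: $I_0,I_1$ are the modified Bessel functions of the first kind of orders 0 and 1. The von Mises density with mean $\mu$ and precision $\kappa$ is $\mathcal{VM}(z;\mu,\kappa)=\frac{1}{2\pi I_0(\kappa)}\exp(\kappa\cos(z-\mu))$ on $[0,2\pi)$. The Fisher information about $\varphi_t$ is $$\mathcal{I}(\varphi_t)=\mathbb{E}_{Z_t}\left[\left(\frac{\partial}{\partial\phi}\log\mathcal{VM}(Z_t;h(\phi),\alpha)\right)^2\Big|_{\phi=\varphi_t}\right],$$ where $Z_t\sim\mathcal{VM}(h(\varphi_t),\alpha)$ and $\alpha=\alpha(\kappa_z,\Delta t)$ does not depend on $\phi$. *)

theory Defs
  imports "HOL-Analysis.Analysis"
begin

text \<open>
  The circle is \<^term>\<open>sphere (0::complex) 1\<close>. The angle \<^term>\<open>phi :: real\<close>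
  denotes the point \<^term>\<open>cis phi\<close>, and a point \<^term>\<open>w\<close> of the circle has the angle
  \<^term>\<open>Arg2pi w\<close> in \<^term>\<open>{0..<2*pi}\<close>.
\<close>

definition bessel_I :: "nat \<Rightarrow> real \<Rightarrow> real" where
  "bessel_I n x = (\<Sum>m. (x / 2) ^ (2 * m + n) / (fact m * fact (m + n)))"

definition xi :: "real \<Rightarrow> real" where
  "xi x = x * (bessel_I 1 x / bessel_I 0 x)"

definition xi_inv :: "real \<Rightarrow> real" where
  "xi_inv = inv_into {0..} xi"

definition von_mises_density :: "real \<Rightarrow> real \<Rightarrow> real \<Rightarrow> real" where
  "von_mises_density \<mu> \<kappa> z = 1 / (2 * pi * bessel_I 0 \<kappa>) * exp (\<kappa> * cos (z - \<mu>))"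

definition von_mises :: "real \<Rightarrow> real \<Rightarrow> real measure" where
  "von_mises \<mu> \<kappa> =
     density (restrict_space lborel {0..<2 * pi}) (\<lambda>z. ennreal (von_mises_density \<mu> \<kappa> z))"

text \<open>
  The derivative is taken along the angle coordinate. The jump of \<^const>\<open>Arg2pi\<close> at angle 0
  does no harm, since \<^const>\<open>von_mises_density\<close> is \<open>2 * pi\<close>-periodic in the mean.
  The expectation over an observation is the integral over its law.
\<close>

definition fisher_information :: "(complex \<Rightarrow> complex) \<Rightarrow> real \<Rightarrow> real \<Rightarrow> real" where
  "fisher_information h \<alpha> \<phi>t =
     (\<integral>z. (deriv (\<lambda>\<phi>. ln (von_mises_density (Arg2pi (h (cis \<phi>))) \<alpha> z)) \<phi>t)\<^sup>2
        \<partial>von_mises (Arg2pi (h (cis \<phi>t))) \<alpha>)"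

end

theory Submission
  imports Defs
begin

text \<open>
  Since \<open>cis (Arg2pi w) = w\<close> on the circle, the score at \<open>z\<close> is
  \<open>\<alpha> * \<omega> * sin (z - \<mu>)\<close>, where \<open>\<omega>\<close> is the angular speed of \<open>h\<close> along the circle and \<open>\<mu>\<close> the
  angle of \<open>h (cis \<phi>t)\<close>. Integrating by parts turns \<open>\<alpha>\<close> times the integral of
  \<open>sin\<^sup>2 * exp (\<alpha> * cos)\<close> into that of \<open>cos * exp (\<alpha> * cos)\<close>, which is \<open>2 * pi * I\<^sub>1(\<alpha>)\<close> by termwise
  integration. So the Fisher information is \<open>\<omega>\<^sup>2 * xi \<alpha>\<close>, and \<open>xi\<close> undoes \<open>xi_inv\<close> because it is onto
  \<open>[0, \<infinity>)\<close>: it is continuous, vanishes at 0, and satisfies \<open>xi x \<ge> x - 1\<close>.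
\<close>

section \<open>Bessel functions and xi\<close>

text \<open>The exponential series dominates, as \<open>fact (m + n)\<close> is at least 1. With
  \<open>y\<close> set to \<open>(x / 2)\<^sup>2\<close> this is the Bessel series stripped of the
  factor \<open>(x / 2) ^ n\<close>, so continuity can be read off a power series.\<close>

lemma bessel_coeff_summable:
  fixes y :: real
  shows "summable (\<lambda>m. 1 / (fact m * fact (m + n)) * y ^ m)"
proof (rule summable_comparison_test')
  show "summable (\<lambda>m. inverse (fact m) * \<bar>y\<bar> ^ m)"
    by (rule summable_exp)
next
  fix m :: nat
  have "fact m * 1 \<le> fact m * (fact (m + n) :: real)"
    by (intro mult_left_mono) auto
  then have "1 / (fact m * fact (m + n)) \<le> inverse (fact m :: real)"
    by (simp add: divide_simps)
  then show "norm (1 / (fact m * fact (m + n)) * y ^ m) \<le> inverse (fact m) * \<bar>y\<bar> ^ m"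
    by (simp add: abs_mult power_abs mult_right_mono divide_inverse)
qed

lemma bessel_term_eq:
  "(x / 2) ^ (2 * m + n) / (fact m * fact (m + n)) =
    (x / 2) ^ n * (1 / (fact m * fact (m + n)) * ((x / 2)\<^sup>2) ^ m)" for x :: real
  by (simp add: power_add power_mult)

lemma bessel_I_sums:
  "(\<lambda>m. (x / 2) ^ (2 * m + n) / (fact m * fact (m + n))) sums bessel_I n x"
  unfolding bessel_I_def
  by (rule summable_sums, subst bessel_term_eq, rule summable_mult, rule bessel_coeff_summable)

lemma bessel_I_powser:
  "bessel_I n x = (x / 2) ^ n * (\<Sum>m. 1 / (fact m * fact (m + n)) * ((x / 2)\<^sup>2) ^ m)"
  unfolding bessel_I_def bessel_term_eq
  by (rule suminf_mult[OF bessel_coeff_summable])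

lemma isCont_bessel_I: "isCont (bessel_I n) x"
proof -
  have "isCont (\<lambda>y. \<Sum>m. 1 / (fact m * fact (m + n)) * y ^ m) z" for z :: real
    by (rule isCont_powser_converges_everywhere) (rule bessel_coeff_summable)
  then have "isCont (\<lambda>x. (x / 2) ^ n * (\<Sum>m. 1 / (fact m * fact (m + n)) * ((x / 2)\<^sup>2) ^ m)) x"
    by (intro continuous_intros isCont_o2[where f = "\<lambda>x. (x / 2)\<^sup>2"]) auto
  then show ?thesis
    unfolding bessel_I_powser[abs_def] .
qed

lemma bessel_I_0_pos: "bessel_I 0 x > 0"
  unfolding bessel_I_def
proof (rule suminf_pos2[where i = 0])
  show "summable (\<lambda>m. (x / 2) ^ (2 * m + 0) / (fact m * fact (m + 0)))"
    using bessel_I_sums[of x 0] by (rule sums_summable)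
qed (auto simp: power_mult)

lemma continuous_on_xi: "continuous_on A xi"
  unfolding xi_def[abs_def]
  by (intro continuous_at_imp_continuous_on ballI continuous_intros isCont_bessel_I)
     (simp add: less_imp_neq[OF bessel_I_0_pos, symmetric])

text \<open>
  With \<open>t = x / 2\<close> and \<open>a m = t ^ (2 * m) / (fact m)\<^sup>2\<close>, the series for \<open>t * I\<^sub>1\<close> is the sum
  of \<open>m * a m\<close>, and summing \<open>2 * t * a m \<le> (m + 1) * a m + t\<^sup>2 / (m + 1) * a m\<close> gives
  \<open>2 * t * I\<^sub>0 \<le> I\<^sub>0 + 2 * t * I\<^sub>1\<close>.
\<close>
lemma xi_ge: "xi x \<ge> x - 1"
proof -
  define t where "t = x / 2"
  define a where "a m = t ^ (2 * m) / (fact m)\<^sup>2" for m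
  have a_sums: "a sums bessel_I 0 x"
    using bessel_I_sums[of x 0] by (simp add: a_def[abs_def] t_def power2_eq_square)
  have shifted: "real (Suc m) * a (Suc m) = t * (t ^ (2 * m + 1) / (fact m * fact (m + 1)))" for m
    by (simp add: a_def power2_eq_square del: of_nat_Suc)
  have Suc_sums: "(\<lambda>m. real (Suc m) * a (Suc m)) sums (t * bessel_I 1 x)"
    unfolding shifted using sums_mult[OF bessel_I_sums[of x 1], of t]
    by (simp add: t_def)
  \<comment> \<open>Shifting the index back adds only the term at \<open>m = 0\<close>, which
    vanishes.\<close>
  then have "(\<lambda>m. real m * a m) sums (t * bessel_I 1 x)"
    by (subst (asm) sums_Suc_iff) simp
  from sums_add[OF sums_add[OF this a_sums] Suc_sums]
  have "(\<lambda>m. real m * a m + a m + real (Suc m) * a (Suc m)) sums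
      (t * bessel_I 1 x + bessel_I 0 x + t * bessel_I 1 x)" .
  moreover have "2 * t * a m \<le> real m * a m + a m + real (Suc m) * a (Suc m)" for m
  proof -
    define s where "s = real (Suc m)"
    have "s > 0" by (simp add: s_def)
    have "a m \<ge> 0" by (simp add: a_def power_mult)
    have "s * a (Suc m) = t\<^sup>2 / s * a m"
      by (simp add: a_def s_def power2_eq_square mult_ac del: of_nat_Suc)
    moreover have "2 * t \<le> s + t\<^sup>2 / s"
    proof -
      \<comment> \<open>AM-GM for \<open>s\<close> and \<open>t\<^sup>2 / s\<close>, by completing
        the square.\<close>
      have "s + t\<^sup>2 / s - 2 * t = (s - t)\<^sup>2 / s"
        using \<open>s > 0\<close> by (simp add: field_simps power2_eq_square)
      also have "\<dots> \<ge> 0" using \<open>s > 0\<close> by simp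
      finally show ?thesis by simp
    qed
    then have "2 * t * a m \<le> (s + t\<^sup>2 / s) * a m"
      using \<open>a m \<ge> 0\<close> by (rule mult_right_mono)
    ultimately show ?thesis
      by (simp add: s_def algebra_simps)
  qed
  ultimately have "2 * t * bessel_I 0 x \<le> t * bessel_I 1 x + bessel_I 0 x + t * bessel_I 1 x"
    by (rule sums_le[OF _ sums_mult[OF a_sums], rotated])
  then have "(x - 1) * bessel_I 0 x \<le> x * bessel_I 1 x"
    by (simp add: t_def algebra_simps)
  then show ?thesis
    using bessel_I_0_pos[of x] by (simp add: xi_def pos_le_divide_eq)
qed

lemma xi_xi_inv:
  assumes "y \<ge> 0"
  shows "xi (xi_inv y) = y"
proof -
  \<comment> \<open>Intermediate value theorem on \<open>{0..y + 1}\<close>: the linear lower bound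
    gives \<open>xi (y + 1) \<ge> y\<close>.\<close>
  have "\<exists>x\<ge>0. x \<le> y + 1 \<and> xi x = y"
    using assms xi_ge[of "y + 1"] by (intro IVT' continuous_on_xi) (auto simp: xi_def)
  then show ?thesis
    unfolding xi_inv_def by (intro f_inv_into_f) auto
qed

section \<open>Integrals over a period\<close>

text \<open>Every integration by parts below takes this form: the boundary terms cancel by
  periodicity.\<close>

lemma has_integral_period:
  fixes F f :: "real \<Rightarrow> real"
  assumes "\<And>z. (F has_real_derivative f z) (at z)" and "F (2 * pi) = F 0"
  shows "(f has_integral 0) {0..2 * pi}"
proof -
  have "(f has_integral (F (2 * pi) - F 0)) {0..2 * pi}"
    using assms(1)
    by (intro fundamental_theorem_of_calculus)
       (auto simp: has_real_derivative_iff_has_vector_derivative[symmetric]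
             intro: has_field_derivative_at_within)
  then show ?thesis by (simp add: assms(2))
qed

text \<open>Wallis reduction: differentiate \<open>sin * cos ^ (k + 1)\<close>, replace
  \<open>sin\<^sup>2\<close> by \<open>1 - cos\<^sup>2\<close>, and integrate over a period.\<close>

lemma cos_power_recurrence:
  assumes "((\<lambda>z. cos (z - \<mu>) ^ k) has_integral w) {0..2 * pi}"
  shows "((\<lambda>z. cos (z - \<mu>) ^ (k + 2)) has_integral (real (k + 1) / real (k + 2) * w)) {0..2 * pi}"
proof -
  have "((\<lambda>z. real (k + 2) * cos (z - \<mu>) ^ (k + 2) - real (k + 1) * cos (z - \<mu>) ^ k)
      has_integral 0) {0..2 * pi}"
  proof (rule has_integral_period)
    fix z
    show "((\<lambda>z. sin (z - \<mu>) * cos (z - \<mu>) ^ (k + 1)) has_real_derivative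
        real (k + 2) * cos (z - \<mu>) ^ (k + 2) - real (k + 1) * cos (z - \<mu>) ^ k) (at z)"
    proof -
      have "cos (z - \<mu>) * cos (z - \<mu>) ^ (k + 1)
          - real (k + 1) * cos (z - \<mu>) ^ k * (sin (z - \<mu>))\<^sup>2
          = real (k + 2) * cos (z - \<mu>) ^ (k + 2) - real (k + 1) * cos (z - \<mu>) ^ k"
        unfolding sin_squared_eq by (simp add: algebra_simps power2_eq_square)
      moreover have "((\<lambda>z. sin (z - \<mu>) * cos (z - \<mu>) ^ (k + 1)) has_real_derivative
          cos (z - \<mu>) * cos (z - \<mu>) ^ (k + 1)
          - real (k + 1) * cos (z - \<mu>) ^ k * (sin (z - \<mu>))\<^sup>2) (at z)"
        by (rule derivative_eq_intros refl | simp)+ (simp add: algebra_simps power2_eq_square)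
      ultimately show ?thesis by simp
    qed
  qed (simp add: sin_diff cos_diff)
  from has_integral_add[OF this has_integral_mult_right[OF assms, of "real (k + 1)"]]
  have "((\<lambda>z. real (k + 2) * cos (z - \<mu>) ^ (k + 2)) has_integral real (k + 1) * w) {0..2 * pi}"
    by simp
  from has_integral_mult_right[OF this, of "1 / real (k + 2)"] show ?thesis
    by (simp del: power_Suc power_add_numeral2 of_nat_add add: mult.assoc[symmetric])
qed

text \<open>Iterating the reduction from \<open>2 * pi\<close> gives the Wallis product, that is
  \<open>2 * pi\<close> times the central binomial coefficient over \<open>4 ^ m\<close>.\<close>

lemma cos_even_power_integral:
  "((\<lambda>z. cos (z - \<mu>) ^ (2 * m)) has_integral (2 * pi * fact (2 * m) / (4 ^ m * (fact m)\<^sup>2)))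
    {0..2 * pi}"
proof (induction m)
  case 0
  then show ?case
    using has_integral_const_real[of "1 :: real" 0 "2 * pi"] by simp
next
  case (Suc m)
  have "real (2 * m + 1) / real (2 * m + 2) * (2 * pi * fact (2 * m) / (4 ^ m * (fact m)\<^sup>2))
      = 2 * pi * fact (2 * Suc m) / (4 ^ Suc m * (fact (Suc m))\<^sup>2)"
    by (simp add: power2_eq_square divide_simps del: of_nat_Suc) (simp add: algebra_simps)
  then show ?case
    using cos_power_recurrence[OF Suc.IH] by simp
qed

lemma cos_odd_power_integral:
  "((\<lambda>z. cos (z - \<mu>) ^ (2 * m + 1)) has_integral 0) {0..2 * pi}"
proof (induction m)
  case 0
  show ?case
    by (rule has_integral_period[where F = "\<lambda>z. sin (z - \<mu>)"])
       (auto intro!: derivative_eq_intros simp: sin_diff cos_diff)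
next
  case (Suc m)
  then show ?case
    using cos_power_recurrence[OF Suc.IH] by simp
qed

text \<open>By the M-test the partial sums converge uniformly, so integral and limit may be
  exchanged.\<close>

lemma has_integral_suminf_Weierstrass:
  fixes f :: "nat \<Rightarrow> real \<Rightarrow> real"
  assumes int: "\<And>k. (f k has_integral w k) {a..b}"
    and cont: "\<And>k. continuous_on {a..b} (f k)"
    and bound: "\<And>k z. z \<in> {a..b} \<Longrightarrow> \<bar>f k z\<bar> \<le> M k"
    and "summable M" and lim: "\<And>z. z \<in> {a..b} \<Longrightarrow> (\<lambda>k. f k z) sums g z"
    and w: "w sums s"
  shows "(g has_integral s) {a..b}"
proof -
  have "uniform_limit {a..b} (\<lambda>n z. \<Sum>k<n. f k z) (\<lambda>z. suminf (\<lambda>k. f k z)) sequentially"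
    by (rule Weierstrass_m_test[OF _ \<open>summable M\<close>]) (use bound in auto)
  then have "uniform_limit (cbox a b) (\<lambda>n z. \<Sum>k<n. f k z) g sequentially"
    using uniform_limit_cong'[where X = "cbox a b" and h = "\<lambda>z. suminf (\<lambda>k. f k z)" and i = g
        and f = "\<lambda>n z. \<Sum>k<n. f k z" and g = "\<lambda>n z. \<Sum>k<n. f k z"] lim
    by (auto simp: sums_iff)
  then obtain I J where IJ:
    "\<And>n. ((\<lambda>z. \<Sum>k<n. f k z) has_integral I n) (cbox a b)"
    "(g has_integral J) (cbox a b)" "(I \<longlongrightarrow> J) sequentially"
    by (rule uniform_limit_integral_cbox) (auto intro: continuous_on_sum cont)
  have sum: "((\<lambda>z. \<Sum>k<n. f k z) has_integral (\<Sum>k<n. w k)) (cbox a b)" for n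
    using int by (intro has_integral_sum) auto
  \<comment> \<open>The limit theorem provides unnamed integrals \<open>I n\<close>; uniqueness
    identifies them with the partial sums of \<open>w\<close>.\<close>
  have "I = (\<lambda>n. \<Sum>k<n. w k)"
    using has_integral_unique[OF IJ(1) sum] by auto
  then have "J = s"
    using IJ(3) w LIMSEQ_unique unfolding sums_def by blast
  then show ?thesis using IJ(2) by simp
qed

text \<open>Expand the exponential. Even \<open>k\<close> leave an odd power of the cosine and
  integrate to 0, while \<open>k = 2 * m + 1\<close> yields \<open>2 * pi\<close> times the
  \<open>m\<close>-th term of the series for \<open>bessel_I 1 x\<close>.\<close>

lemma bessel_I_1_integral:
  "((\<lambda>z. cos (z - \<mu>) * exp (x * cos (z - \<mu>))) has_integral (2 * pi * bessel_I 1 x)) {0..2 * pi}"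
proof -
  define w where "w k = (if odd k then
    2 * pi * ((x / 2) ^ k / (fact (k div 2) * fact (k div 2 + 1))) else 0)" for k
  define f where "f k z = x ^ k / fact k * cos (z - \<mu>) ^ (k + 1)" for k z
  have "w \<circ> (\<lambda>m. 2 * m + 1) = (\<lambda>m. 2 * pi * ((x / 2) ^ (2 * m + 1) / (fact m * fact (m + 1))))"
    by (auto simp: w_def)
  then have "(w \<circ> (\<lambda>m. 2 * m + 1)) sums (2 * pi * bessel_I 1 x)"
    by (simp only: sums_mult[OF bessel_I_sums])
  \<comment> \<open>The zeros at even indices allow passing from the odd subsequence to the full
    series.\<close>
  moreover have "w k = 0" if "k \<notin> range (\<lambda>m. 2 * m + 1)" for k
    using that by (auto simp: w_def elim!: oddE)
  ultimately have w: "w sums (2 * pi * bessel_I 1 x)"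
    using sums_mono_reindex[of "\<lambda>m. 2 * m + 1" w] by (auto simp: strict_mono_def comp_def)
  show ?thesis
  proof (rule has_integral_suminf_Weierstrass[of f, OF _ _ _ _ _ w])
    fix k
    show "(f k has_integral w k) {0..2 * pi}"
    proof (cases "even k")
      case True
      then obtain m where "k = 2 * m" ..
      then show ?thesis
        using has_integral_mult_right[OF cos_odd_power_integral[of \<mu> m], of "x ^ k / fact k"]
        by (simp add: f_def[abs_def] w_def)
    next
      case False
      then obtain m where k: "k = 2 * m + 1" by (auto elim: oddE)
      have "x ^ k / fact k * (2 * pi * fact (2 * Suc m) / (4 ^ Suc m * (fact (Suc m))\<^sup>2)) = w k"
      proof -
        \<comment> \<open>The first identity cancels \<open>fact k\<close>; the second, below, turns
          \<open>x ^ k / 4 ^ Suc m\<close> into half of \<open>(x / 2) ^ k\<close>.\<close>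
        have "(fact (2 * Suc m) :: real) = 2 * real (Suc m) * fact k"
          by (simp add: k algebra_simps)
        moreover have "(4 :: real) ^ Suc m = 2 * 2 ^ k"
          by (simp add: k power_mult)
        ultimately show ?thesis
          by (simp add: w_def k power_divide power2_eq_square mult_ac del: of_nat_Suc power_Suc)
      qed
      then show ?thesis
        using has_integral_mult_right[OF cos_even_power_integral[of \<mu> "Suc m"], of "x ^ k / fact k"]
        by (simp add: f_def[abs_def] k)
    qed
  next
    fix k
    show "continuous_on {0..2 * pi} (f k)"
      unfolding f_def by (intro continuous_intros)
  next
    show "summable (\<lambda>k. inverse (fact k) * \<bar>x\<bar> ^ k)" by (rule summable_exp)
  next
    fix k z
    have "\<bar>cos (z - \<mu>)\<bar> ^ (k + 1) \<le> 1"
      by (intro power_le_one) auto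
    then have "\<bar>x\<bar> ^ k / fact k * \<bar>cos (z - \<mu>)\<bar> ^ (k + 1) \<le> \<bar>x\<bar> ^ k / fact k * 1"
      by (intro mult_left_mono) auto
    then show "\<bar>f k z\<bar> \<le> inverse (fact k) * \<bar>x\<bar> ^ k"
      by (simp add: f_def abs_mult power_abs field_simps)
  next
    fix z
    from sums_mult[OF exp_converges[of "x * cos (z - \<mu>)"], of "cos (z - \<mu>)"]
    show "(\<lambda>k. f k z) sums (cos (z - \<mu>) * exp (x * cos (z - \<mu>)))"
      by (simp add: f_def power_mult_distrib scaleR_conv_of_real field_simps)
  qed
qed

text \<open>The integrand differs from that of \<open>bessel_I_1_integral\<close> by the derivative
  of \<open>sin * exp (x * cos)\<close>. Keeping the factor \<open>x\<close> inside avoids a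
  division and covers \<open>x = 0\<close>.\<close>

lemma sin_squared_exp_cos_integral:
  "((\<lambda>z. x * ((sin (z - \<mu>))\<^sup>2 * exp (x * cos (z - \<mu>)))) has_integral (2 * pi * bessel_I 1 x))
    {0..2 * pi}"
proof -
  have "((\<lambda>z. cos (z - \<mu>) * exp (x * cos (z - \<mu>))
      - x * ((sin (z - \<mu>))\<^sup>2 * exp (x * cos (z - \<mu>)))) has_integral 0) {0..2 * pi}"
    by (rule has_integral_period[where F = "\<lambda>z. sin (z - \<mu>) * exp (x * cos (z - \<mu>))"])
       (auto intro!: derivative_eq_intros simp: sin_diff[of "2 * pi"] cos_diff[of "2 * pi"] power2_eq_square)
  from has_integral_diff[OF bessel_I_1_integral[of \<mu> x] this] show ?thesis
    by simp
qed

section \<open>Fisher information\<close>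

text \<open>Passes from the Lebesgue integral over the law to a gauge integral over the closed
  period, where the formulas above apply.\<close>

lemma integral_von_mises:
  assumes g: "continuous_on UNIV g" and "(g has_integral J) {0..2 * pi}"
    and eq: "\<And>z. f z * von_mises_density \<mu> \<kappa> z = g z"
    and f: "f \<in> borel_measurable borel"
  shows "(\<integral>z. f z \<partial>von_mises \<mu> \<kappa>) = J"
proof -
  have dens_meas: "von_mises_density \<mu> \<kappa> \<in> borel_measurable borel"
    unfolding von_mises_density_def[abs_def] by measurable
  have dens_nonneg: "von_mises_density \<mu> \<kappa> z \<ge> 0" for z
    using bessel_I_0_pos[of \<kappa>] by (simp add: von_mises_density_def)
  have "(\<integral>z. f z \<partial>von_mises \<mu> \<kappa>) =
      (\<integral>z. von_mises_density \<mu> \<kappa> z *\<^sub>R f z \<partial>restrict_space lborel {0..<2 * pi})"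
    unfolding von_mises_def
    using f dens_meas dens_nonneg
    by (intro integral_density) (auto intro!: measurable_restrict_space1)
  also have "\<dots> = (LINT z:{0..<2 * pi}|lborel. g z)"
    unfolding set_lebesgue_integral_def
    by (subst integral_restrict_space) (auto simp: eq[symmetric] mult.commute)
  also have "\<dots> = integral {0..<2 * pi} g"
  proof (rule set_borel_integral_eq_integral(2))
    have "set_integrable lborel {0..2 * pi} g"
      using borel_integrable_compact[of "{0..2 * pi}" g] continuous_on_subset[OF g]
      unfolding set_integrable_def by (simp add: indicator_def if_distrib cong: if_cong)
    then show "set_integrable lborel {0..<2 * pi} g"
      by (rule set_integrable_subset) auto
  qed
  \<comment> \<open>The two intervals differ only in the null set \<open>{2 * pi}\<close>.\<close>
  also have "\<dots> = integral {0..2 * pi} g"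
    by (rule integral_spike_set) (auto intro: negligible_subset[of "{2 * pi}"])
  also have "\<dots> = J"
    using assms(2) by (rule integral_unique)
  finally show ?thesis .
qed

lemma cis_Arg2pi:
  assumes "norm w = 1"
  shows "cis (Arg2pi w) = w"
  using Arg2pi_eq[of w] assms by (simp add: cis_conv_exp)

text \<open>By the addition theorem the log-density is affine in the real and imaginary parts of
  \<open>\<gamma> \<phi>\<close>, which are differentiable even where \<open>Arg2pi\<close>
  jumps.\<close>

lemma von_mises_score:
  assumes unit: "\<And>\<phi>. norm (\<gamma> \<phi>) = 1"
    and deriv: "(\<gamma> has_vector_derivative \<gamma>') (at \<phi>t)"
  defines "\<omega> \<equiv> Re (\<gamma> \<phi>t) * Im \<gamma>' - Im (\<gamma> \<phi>t) * Re \<gamma>'"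
  shows "deriv (\<lambda>\<phi>. ln (von_mises_density (Arg2pi (\<gamma> \<phi>)) \<alpha> z)) \<phi>t =
    \<alpha> * \<omega> * sin (z - Arg2pi (\<gamma> \<phi>t))"
proof -
  have Re_eq: "cos (Arg2pi (\<gamma> \<phi>)) = Re (\<gamma> \<phi>)" and Im_eq: "sin (Arg2pi (\<gamma> \<phi>)) = Im (\<gamma> \<phi>)" for \<phi>
    using arg_cong[OF cis_Arg2pi[OF unit[of \<phi>]], of Re]
      arg_cong[OF cis_Arg2pi[OF unit[of \<phi>]], of Im] by simp_all
  have dRe: "((\<lambda>\<phi>. Re (\<gamma> \<phi>)) has_real_derivative Re \<gamma>') (at \<phi>t)"
    and dIm: "((\<lambda>\<phi>. Im (\<gamma> \<phi>)) has_real_derivative Im \<gamma>') (at \<phi>t)"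
    using deriv
    by (simp_all add: has_real_derivative_iff_has_vector_derivative
        bounded_linear.has_vector_derivative[OF bounded_linear_Re]
        bounded_linear.has_vector_derivative[OF bounded_linear_Im])
  have unit2: "(Re (\<gamma> \<phi>))\<^sup>2 + (Im (\<gamma> \<phi>))\<^sup>2 = 1" for \<phi>
    using unit[of \<phi>] by (simp add: cmod_def)
  \<comment> \<open>Differentiating the constant squared norm shows that the velocity is orthogonal
    to the position.\<close>
  have "((\<lambda>\<phi>. (Re (\<gamma> \<phi>))\<^sup>2 + (Im (\<gamma> \<phi>))\<^sup>2) has_real_derivative
      2 * (Re (\<gamma> \<phi>t) * Re \<gamma>' + Im (\<gamma> \<phi>t) * Im \<gamma>')) (at \<phi>t)"
    by (rule derivative_eq_intros dRe dIm refl)+ (simp add: algebra_simps)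
  then have orth: "Re (\<gamma> \<phi>t) * Re \<gamma>' + Im (\<gamma> \<phi>t) * Im \<gamma>' = 0"
    unfolding unit2 using DERIV_unique[OF _ DERIV_const] by fastforce
  \<comment> \<open>In complex form, \<open>\<gamma>'\<close> is
    \<open>\<i> * \<omega> * \<gamma> \<phi>t\<close>, so \<open>\<omega>\<close> is the signed
    angular speed.\<close>
  have Re': "Re \<gamma>' = - \<omega> * Im (\<gamma> \<phi>t)" and Im': "Im \<gamma>' = \<omega> * Re (\<gamma> \<phi>t)"
    using unit2[of \<phi>t] orth unfolding \<omega>_def by algebra+
  have "(\<lambda>\<phi>. ln (von_mises_density (Arg2pi (\<gamma> \<phi>)) \<alpha> z)) =
      (\<lambda>\<phi>. ln (1 / (2 * pi * bessel_I 0 \<alpha>)) + \<alpha> * (cos z * Re (\<gamma> \<phi>) + sin z * Im (\<gamma> \<phi>)))"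
    unfolding von_mises_density_def
    using bessel_I_0_pos[of \<alpha>] by (subst ln_mult) (auto simp: cos_diff Re_eq Im_eq)
  moreover have "((\<lambda>\<phi>. ln (1 / (2 * pi * bessel_I 0 \<alpha>))
        + \<alpha> * (cos z * Re (\<gamma> \<phi>) + sin z * Im (\<gamma> \<phi>)))
      has_real_derivative (\<alpha> * (cos z * Re \<gamma>' + sin z * Im \<gamma>'))) (at \<phi>t)"
    by (rule derivative_eq_intros dRe dIm refl)+ simp
  moreover have "\<alpha> * (cos z * Re \<gamma>' + sin z * Im \<gamma>') = \<alpha> * \<omega> * sin (z - Arg2pi (\<gamma> \<phi>t))"
    by (simp add: Re' Im' sin_diff Re_eq Im_eq algebra_simps)
  ultimately show ?thesis
    by (simp add: DERIV_imp_deriv)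
qed

lemma fisher_information_eq:
  assumes "h \<in> sphere 0 1 \<rightarrow> sphere 0 1"
    and "((\<lambda>\<phi>. h (cis \<phi>)) has_vector_derivative \<gamma>') (at \<phi>t)"
  defines "\<omega> \<equiv> Re (h (cis \<phi>t)) * Im \<gamma>' - Im (h (cis \<phi>t)) * Re \<gamma>'"
  shows "fisher_information h \<alpha> \<phi>t = \<omega>\<^sup>2 * xi \<alpha>"
proof -
  define \<mu> where "\<mu> = Arg2pi (h (cis \<phi>t))"
  \<comment> \<open>\<open>C\<close> takes only one of the two factors \<open>\<alpha>\<close> of
    the squared score; the other stays in the integrand to match
    \<open>sin_squared_exp_cos_integral\<close>.\<close>
  define C where "C = \<alpha> * \<omega>\<^sup>2 / (2 * pi * bessel_I 0 \<alpha>)"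
  have "norm (h (cis \<phi>)) = 1" for \<phi>
    using assms(1) by (auto simp: Pi_iff)
  then have score: "deriv (\<lambda>\<phi>. ln (von_mises_density (Arg2pi (h (cis \<phi>))) \<alpha> z)) \<phi>t =
      \<alpha> * \<omega> * sin (z - \<mu>)" for z
    unfolding \<omega>_def \<mu>_def
    by (rule von_mises_score[where \<gamma> = "\<lambda>\<phi>. h (cis \<phi>)"]) (rule assms(2))
  have "(\<integral>z. (\<alpha> * \<omega> * sin (z - \<mu>))\<^sup>2 \<partial>von_mises \<mu> \<alpha>) = C * (2 * pi * bessel_I 1 \<alpha>)"
  proof (rule integral_von_mises)
    show "((\<lambda>z. C * (\<alpha> * ((sin (z - \<mu>))\<^sup>2 * exp (\<alpha> * cos (z - \<mu>)))))
        has_integral C * (2 * pi * bessel_I 1 \<alpha>)) {0..2 * pi}"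
      by (rule has_integral_mult_right) (rule sin_squared_exp_cos_integral)
    show "continuous_on UNIV (\<lambda>z. C * (\<alpha> * ((sin (z - \<mu>))\<^sup>2 * exp (\<alpha> * cos (z - \<mu>)))))"
      by (intro continuous_intros)
  qed (simp_all add: von_mises_density_def C_def power_mult_distrib power2_eq_square)
  also have "\<dots> = \<omega>\<^sup>2 * xi \<alpha>"
    by (simp add: C_def xi_def)
  finally show ?thesis
    by (simp add: fisher_information_def score \<mu>_def[symmetric])
qed

theorem theorem2:
  fixes h :: "complex \<Rightarrow> complex" and \<alpha> :: "real \<Rightarrow> real \<Rightarrow> real" and \<phi>t :: real
  assumes "h \<in> sphere 0 1 \<rightarrow> sphere 0 1"
    and "h differentiable_on sphere 0 1"
    and "\<And>\<kappa>z \<Delta>t. \<kappa>z > 0 \<Longrightarrow> \<Delta>t > 0 \<Longrightarrow> \<alpha> \<kappa>z \<Delta>t = xi_inv (\<kappa>z * \<Delta>t)"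
  shows "\<exists>c. \<forall>\<kappa>z>0. \<forall>\<Delta>t>0. fisher_information h (\<alpha> \<kappa>z \<Delta>t) \<phi>t = c * (\<kappa>z * \<Delta>t)"
proof -
  have "cis differentiable (at \<phi>t)"
    using has_derivative_cis[OF has_derivative_ident] by (auto simp: differentiable_def)
  \<comment> \<open>Differentiability of \<open>h\<close> is given only relative to the circle; this
    suffices for the chain rule because \<open>cis\<close> takes its values there.\<close>
  moreover have "h differentiable (at (cis \<phi>t) within range cis)"
  proof (rule differentiable_within_subset)
    show "h differentiable (at (cis \<phi>t) within sphere 0 1)"
      using assms(2) by (simp add: differentiable_on_def)
  qed auto
  ultimately have "(h \<circ> cis) differentiable (at \<phi>t)"
    by (rule differentiable_chain_within)
  then obtain \<gamma>' where "((\<lambda>\<phi>. h (cis \<phi>)) has_vector_derivative \<gamma>') (at \<phi>t)"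
    by (auto simp: comp_def vector_derivative_works)
  \<comment> \<open>The constant \<open>c\<close> is the squared angular speed of \<open>h\<close>
    along the circle, fixed by \<open>h\<close> and \<open>\<phi>t\<close> alone.\<close>
  from fisher_information_eq[OF assms(1) this] show ?thesis
    by (auto simp: assms(3) xi_xi_inv)
qed

end
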